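(* Under Assumptions 1 and 2, there exists a constant $K$ (depending only on $\bar r,\bar a,\underline d,\mu$) such that for every dual-based policy $\bm\pi$, every $n>0$ and every $\mathcal P\in\Xi$, $$\mathbb E_{\mathcal P}\big[R_n^*-R_n(\bm\pi)\big]\le K\cdot\mathbb E_{\mathcal P}\Big[\sum_{t=1}^{\tau_{\bar a}}\|\bm p_t-\bm p^*\|_2^2+(n-\tau_{\bar a})+\sum_{i\in I_B}b_{in}\Big].$$
   Context: Linear program: $\max\sum_{j=1}^n r_jx_j$ s.t. $\sum_{j=1}^n a_{ij}x_j\le b_i$ ($i=1,\dots,m$), $0\le x_j\le1$; $b_i>0$, $d_i=b_i/n$, $\bm d=(d_1,\dots,d_m)^\top$. Its optimal value is $R_n^*$. Assumption 1: (a) $(r_j,\bm a_j)\in\mathbb R\times\mathbb R^m$ i.i.d. from $\mathcal P$; (b) $|r_j|\le\bar r$, $\|\bm a_j\|_2\le\bar a$; (c) $d_i\in(\underline d,\bar d)$ with $0<\underline d<\bar d$, $\Omega_d=\prod_i(\underline d,\bar d)$; (d) $n>m$. $f(\bm p)=\bm d^\top\bm p+\mathbb E[(r-\bm a^\top\bm p)^+]$, $(r,\bm a)\sim\mathcal P$; $\bm p^*$ a minimizer of $f$ over $\bm p\ge0$; $\Omega_p=\{\bm p\ge0:\sum_ip_i\le\bar r/\underline d\}$. Assumption 2 (constants $\lambda_{\min},\lambda,\mu>0$): (a) $\mathbb E[\bm a\bm a^\top]$ positive definite with minimum eigenvalue $\lambda_{\min}$; (b) for every $\bm d\in\Omega_d$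 (with $\bm p^*$ the corresponding minimizer) and all $\bm p\in\Omega_p$: $\lambda|\bm a^\top\bm p-\bm a^\top\bm p^*|\le|\mathbb P(r>\bm a^\top\bm p\mid\bm a)-\mathbb P(r>\bm a^\top\bm p^*\mid\bm a)|\le\mu|\bm a^\top\bm p-\bm a^\top\bm p^*|$; (c) $p_i^*=0$ iff $d_i-\mathbb E[a_iI(r>\bm a^\top\bm p^* )]>0$. $\Xi$ is the family of all such $\mathcal P$. Binding set: $I_B=\{i: d_i-\mathbb E[a_iI(r>\bm a^\top\bm p^* )]=0\}$. Online setting: at time $t$ the pair $(r_t,\bm a_t)$ is revealed and $x_t$ is chosen irrevocably. A dual-based policy $\bm\pi$ computes, before observing $(r_t,\bm a_t)$, a vector $\bm p_t=h_t(\mathcal H_{t-1})\in\mathbb R^m$, where $\mathcal H_{t-1}=\{(r_j,\bm a_j,x_j)\}_{j<t}$; sets $\tilde x_t=1$ if $r_t>\bm a_t^\top\bm p_t$ and $0$ otherwise; and sets $x_t=\tilde x_t$ if $\sum_{j<t}a_{ij}x_j+a_{it}\tilde x_t\le b_i$ for all $i$, else $x_t=0$. $R_n(\bm\pi)=\sum_{t=1}^n r_tx_t$. Remaining capacity: $\bm b_0=\bm b$, $\bm b_t=\bm b_{t-1}-\bm a_tx_t$, $\bm b_t=(b_{1t},\dots,b_{mt})^\top$. For $s>0$, $\tau_s=\min(\{n\}\cup\{t\ge1:\min_ib_{it}<s\})$.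
   Formalization: The prices p_t with t ≤ τ_ā are additionally assumed to lie almost surely in Ω_p, since Assumption 2(b) controls the law of r only there and the bound fails for prices outside it (e.g. slightly negative constant prices when r has an atom just below 0). *)

theory Defs
  imports "HOL-Probability.Probability" "Jordan_Normal_Form.Char_Poly"
begin

text \<open>
  The number of constraints \<open>m\<close> is a natural number rather than a type, so that the constant of the
  theorem can be chosen before \<open>m\<close>. Constraints are indexed by \<open>{..<m}\<close>, periods by \<open>{1..n}\<close>, and
  vectors in \<open>m\<close>-space are functions of which only the values on \<open>{..<m}\<close> matter.
\<close>

type_synonym arrival = "real \<times> (nat \<Rightarrow> real)"

abbreviation vec_borel :: "nat \<Rightarrow> (nat \<Rightarrow> real) measure" where
  "vec_borel m \<equiv> PiM {..<m} (\<lambda>_. borel)"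

definition dot :: "nat \<Rightarrow> (nat \<Rightarrow> real) \<Rightarrow> (nat \<Rightarrow> real) \<Rightarrow> real" where
  "dot m u v = (\<Sum>i<m. u i * v i)"

subsection \<open>The offline linear program\<close>

definition lp_feasible :: "nat \<Rightarrow> nat \<Rightarrow> (nat \<Rightarrow> real) \<Rightarrow> (nat \<Rightarrow> arrival) \<Rightarrow> (nat \<Rightarrow> real) set" where
  "lp_feasible m n b w = {x. (\<forall>i<m. (\<Sum>j=1..n. snd (w j) i * x j) \<le> b i) \<and>
                             (\<forall>j\<in>{1..n}. 0 \<le> x j \<and> x j \<le> 1)}"

definition lp_value :: "nat \<Rightarrow> nat \<Rightarrow> (nat \<Rightarrow> real) \<Rightarrow> (nat \<Rightarrow> arrival) \<Rightarrow> real" where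
  "lp_value m n b w = (SUP x\<in>lp_feasible m n b w. \<Sum>j=1..n. fst (w j) * x j)"

subsection \<open>The stochastic program and its dual optimum\<close>

definition dual_obj :: "nat \<Rightarrow> arrival measure \<Rightarrow> (nat \<Rightarrow> real) \<Rightarrow> (nat \<Rightarrow> real) \<Rightarrow> real" where
  "dual_obj m P d p = dot m d p + (\<integral>z. max 0 (fst z - dot m (snd z) p) \<partial>P)"

definition dual_opt :: "nat \<Rightarrow> arrival measure \<Rightarrow> (nat \<Rightarrow> real) \<Rightarrow> (nat \<Rightarrow> real) \<Rightarrow> bool" where
  "dual_opt m P d p \<longleftrightarrow> is_arg_min (dual_obj m P d) (\<lambda>q. \<forall>i<m. 0 \<le> q i) p"

definition Omega_d :: "nat \<Rightarrow> real \<Rightarrow> real \<Rightarrow> (nat \<Rightarrow> real) set" where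
  "Omega_d m dlow dbar = {d. \<forall>i<m. d i \<in> {dlow<..<dbar}}"

definition Omega_p :: "nat \<Rightarrow> real \<Rightarrow> real \<Rightarrow> (nat \<Rightarrow> real) set" where
  "Omega_p m rbar dlow = {p. (\<forall>i<m. 0 \<le> p i) \<and> (\<Sum>i<m. p i) \<le> rbar / dlow}"

text \<open>
  \<open>assumption2\<close> controls the law of \<open>r\<close> given \<open>a\<close> only at prices in \<open>Omega_p\<close>, and the regret bound fails
  for prices outside it. Take \<open>m = 1\<close>, \<open>a = 1\<close>, and let \<open>r\<close> be \<open>-e\<close> with probability \<open>1/2\<close> and otherwise
  uniform on \<open>[0,1]\<close>; let \<open>dlow = 2\<close>, \<open>dbar = 3\<close>, \<open>d = 5/2\<close>. Then the dual optimum is \<open>0\<close>, the constant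
  price \<open>-2e\<close> accepts everything and loses \<open>n e / 2\<close>, but the right-hand side is \<open>K * 4 n e\<^sup>2\<close>. This
  is why the theorem asks that the prices up to the stopping time lie in \<open>Omega_p\<close>.
\<close>

definition accept_set :: "nat \<Rightarrow> (nat \<Rightarrow> real) \<Rightarrow> arrival set" where
  "accept_set m p = {z. fst z > dot m (snd z) p}"

text \<open>The slack \<open>d\<^sub>i - E[a\<^sub>i I(r > a\<^sup>T p)]\<close>.\<close>

definition slack :: "nat \<Rightarrow> arrival measure \<Rightarrow> (nat \<Rightarrow> real) \<Rightarrow> (nat \<Rightarrow> real) \<Rightarrow> nat \<Rightarrow> real" where
  "slack m P d p i = d i - (\<integral>z. snd z i * indicator (accept_set m p) z \<partial>P)"

definition binding :: "nat \<Rightarrow> arrival measure \<Rightarrow> (nat \<Rightarrow> real) \<Rightarrow> (nat \<Rightarrow> real) \<Rightarrow> nat set" where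
  "binding m P d p = {i. i < m \<and> slack m P d p i = 0}"

text \<open>
  The conditional probability \<open>P(r > a\<^sup>T p | a)\<close>: the conditional expectation of the indicator with
  respect to the sub-sigma-algebra generated by the second projection.
\<close>

definition accept_cond_prob :: "nat \<Rightarrow> arrival measure \<Rightarrow> (nat \<Rightarrow> real) \<Rightarrow> arrival \<Rightarrow> real" where
  "accept_cond_prob m P p =
     real_cond_exp P (vimage_algebra (space P) snd (vec_borel m)) (indicator (accept_set m p))"

definition second_moment :: "nat \<Rightarrow> arrival measure \<Rightarrow> real mat" where
  "second_moment m P = mat m m (\<lambda>(i, j). \<integral>z. snd z i * snd z j \<partial>P)"

definition pos_def_mat :: "nat \<Rightarrow> real mat \<Rightarrow> bool" where
  "pos_def_mat m A \<longleftrightarrow> (\<forall>v\<in>carrier_vec m. v \<noteq> 0\<^sub>v m \<longrightarrow> 0 < scalar_prod v (A *\<^sub>v v))"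

definition min_eigenvalue :: "real mat \<Rightarrow> real \<Rightarrow> bool" where
  "min_eigenvalue A l \<longleftrightarrow> eigenvalue A l \<and> (\<forall>k. eigenvalue A k \<longrightarrow> l \<le> k)"

subsection \<open>The assumptions\<close>

text \<open>
  The sampling assumption is split: the i.i.d. sequence is the product of \<open>n\<close> copies of \<open>P\<close>, see
  \<open>sample\<close> below.
\<close>

definition assumption1 ::
    "real \<Rightarrow> real \<Rightarrow> real \<Rightarrow> real \<Rightarrow> nat \<Rightarrow> nat \<Rightarrow> (nat \<Rightarrow> real) \<Rightarrow> arrival measure \<Rightarrow> bool" where
  "assumption1 rbar abar dlow dbar m n d P \<longleftrightarrow>
     prob_space P \<and> sets P = sets (borel \<Otimes>\<^sub>M vec_borel m) \<and>
     (AE z in P. \<bar>fst z\<bar> \<le> rbar \<and> L2_set (snd z) {..<m} \<le> abar) \<and>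
     0 < dlow \<and> dlow < dbar \<and> d \<in> Omega_d m dlow dbar \<and>
     0 < m \<and> m < n"

definition assumption2 ::
    "real \<Rightarrow> real \<Rightarrow> real \<Rightarrow> real \<Rightarrow> real \<Rightarrow> real \<Rightarrow> nat \<Rightarrow> (nat \<Rightarrow> real) \<Rightarrow> arrival measure \<Rightarrow> bool" where
  "assumption2 rbar dlow dbar lmin lam mu m d P \<longleftrightarrow>
     0 < lmin \<and> 0 < lam \<and> 0 < mu \<and>
     pos_def_mat m (second_moment m P) \<and> min_eigenvalue (second_moment m P) lmin \<and>
     (\<forall>d'\<in>Omega_d m dlow dbar. \<forall>ps. dual_opt m P d' ps \<longrightarrow>
       (\<forall>p\<in>Omega_p m rbar dlow. AE z in P.
          lam * \<bar>dot m (snd z) p - dot m (snd z) ps\<bar>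
            \<le> \<bar>accept_cond_prob m P p z - accept_cond_prob m P ps z\<bar> \<and>
          \<bar>accept_cond_prob m P p z - accept_cond_prob m P ps z\<bar>
            \<le> mu * \<bar>dot m (snd z) p - dot m (snd z) ps\<bar>)) \<and>
     (\<forall>ps. dual_opt m P d ps \<longrightarrow> (\<forall>i<m. ps i = 0 \<longleftrightarrow> 0 < slack m P d ps i))"

subsection \<open>Dual-based policies\<close>

text \<open>
  A history before period \<open>t\<close> is a function on \<open>{1..<t}\<close> with values \<open>(r\<^sub>j, a\<^sub>j, x\<^sub>j)\<close>; a policy
  is the sequence of maps \<open>h t\<close> from such histories to price vectors. Measurability is what makes
  the expectations below meaningful.
\<close>

type_synonym hist = "nat \<Rightarrow> real \<times> (nat \<Rightarrow> real) \<times> real"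

definition dual_policy :: "nat \<Rightarrow> nat \<Rightarrow> (nat \<Rightarrow> hist \<Rightarrow> nat \<Rightarrow> real) \<Rightarrow> bool" where
  "dual_policy m n h \<longleftrightarrow>
     (\<forall>t\<in>{1..n}. h t \<in> measurable (PiM {1..<t} (\<lambda>_. borel \<Otimes>\<^sub>M vec_borel m \<Otimes>\<^sub>M borel)) (vec_borel m))"

definition decide ::
    "nat \<Rightarrow> (nat \<Rightarrow> real) \<Rightarrow> nat \<Rightarrow> hist \<Rightarrow> (nat \<Rightarrow> real) \<Rightarrow> arrival \<Rightarrow> real" where
  "decide m b t H p z =
     (let x = indicator (accept_set m p) z
      in if \<forall>i<m. (\<Sum>j\<in>{1..<t}. fst (snd (H j)) i * snd (snd (H j))) + snd z i * x \<le> b i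
         then x else 0)"

text \<open>
  \<open>history m b h w t\<close> is the record of the periods \<open>1..t\<close>; it is \<open>undefined\<close> elsewhere, hence an
  element of the product space over \<open>{1..t}\<close>.
\<close>

primrec history ::
    "nat \<Rightarrow> (nat \<Rightarrow> real) \<Rightarrow> (nat \<Rightarrow> hist \<Rightarrow> nat \<Rightarrow> real) \<Rightarrow> (nat \<Rightarrow> arrival) \<Rightarrow> nat \<Rightarrow> hist" where
  "history m b h w 0 = (\<lambda>_. undefined)"
| "history m b h w (Suc t) =
     (let H = history m b h w t
      in H(Suc t := (fst (w (Suc t)), snd (w (Suc t)),
                     decide m b (Suc t) H (h (Suc t) H) (w (Suc t)))))"

definition price ::
    "nat \<Rightarrow> (nat \<Rightarrow> real) \<Rightarrow> (nat \<Rightarrow> hist \<Rightarrow> nat \<Rightarrow> real) \<Rightarrow> (nat \<Rightarrow> arrival) \<Rightarrow> nat \<Rightarrow> nat \<Rightarrow> real" where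
  "price m b h w t = h t (history m b h w (t - 1))"

definition decision ::
    "nat \<Rightarrow> (nat \<Rightarrow> real) \<Rightarrow> (nat \<Rightarrow> hist \<Rightarrow> nat \<Rightarrow> real) \<Rightarrow> (nat \<Rightarrow> arrival) \<Rightarrow> nat \<Rightarrow> real" where
  "decision m b h w t = snd (snd (history m b h w t t))"

definition revenue ::
    "nat \<Rightarrow> nat \<Rightarrow> (nat \<Rightarrow> real) \<Rightarrow> (nat \<Rightarrow> hist \<Rightarrow> nat \<Rightarrow> real) \<Rightarrow> (nat \<Rightarrow> arrival) \<Rightarrow> real" where
  "revenue m n b h w = (\<Sum>t=1..n. fst (w t) * decision m b h w t)"

primrec remaining ::
    "nat \<Rightarrow> (nat \<Rightarrow> real) \<Rightarrow> (nat \<Rightarrow> hist \<Rightarrow> nat \<Rightarrow> real) \<Rightarrow> (nat \<Rightarrow> arrival) \<Rightarrow> nat \<Rightarrow> nat \<Rightarrow> real" where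
  "remaining m b h w 0 = b"
| "remaining m b h w (Suc t) =
     (\<lambda>i. remaining m b h w t i - snd (w (Suc t)) i * decision m b h w (Suc t))"

definition stop_time ::
    "nat \<Rightarrow> nat \<Rightarrow> (nat \<Rightarrow> real) \<Rightarrow> (nat \<Rightarrow> hist \<Rightarrow> nat \<Rightarrow> real) \<Rightarrow> real \<Rightarrow> (nat \<Rightarrow> arrival) \<Rightarrow> nat" where
  "stop_time m n b h s w =
     Inf ({n} \<union> {t. 1 \<le> t \<and> Min ((\<lambda>i. remaining m b h w t i) ` {..<m}) < s})"

abbreviation sample :: "nat \<Rightarrow> arrival measure \<Rightarrow> (nat \<Rightarrow> arrival) measure" where
  "sample n P \<equiv> PiM {1..n} (\<lambda>_. P)"

end

theory Submission
  imports Defs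
begin

text \<open>
  Let \<open>q\<close> be the dual optimum and \<open>s\<^sub>t = r\<^sub>t - a\<^sub>t\<^sup>T q\<close>. Weak duality bounds the offline value by
  \<open>b\<^sup>T q + \<Sum>\<^sub>t s\<^sub>t\<^sup>+\<close>, while the revenue equals \<open>(b - b\<^sub>n)\<^sup>T q + \<Sum>\<^sub>t s\<^sub>t x\<^sub>t\<close>, so on every sample path
  the regret is at most \<open>\<Sum>\<^sub>t (s\<^sub>t\<^sup>+ - s\<^sub>t x\<^sub>t) + b\<^sub>n\<^sup>T q\<close>.

  In \<open>b\<^sub>n\<^sup>T q\<close> only binding constraints contribute, by complementary slackness. Each period after
  the stopping time \<open>\<tau>\<close> costs a bounded amount. Before \<open>\<tau>\<close> the capacity check passes and a period
  costs \<open>s\<^sub>t (I(r\<^sub>t > a\<^sub>t\<^sup>T q) - I(r\<^sub>t > a\<^sub>t\<^sup>T p\<^sub>t)) \<le> a\<^sub>t\<^sup>T (q - p\<^sub>t) (I(r\<^sub>t > a\<^sub>t\<^sup>T p\<^sub>t) - I(r\<^sub>t > a\<^sub>t\<^sup>T q))\<close>. As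
  \<open>p\<^sub>t\<close> is independent of \<open>(r\<^sub>t, a\<^sub>t)\<close>, conditioning on \<open>a\<^sub>t\<close> and the Lipschitz assumption bound the
  expectation of the latter by \<open>mu abar\<^sup>2 E |p\<^sub>t - q|\<^sup>2\<close>.
\<close>

subsection \<open>A single arrival\<close>

lemma abs_dot_le: "\<bar>dot m u v\<bar> \<le> L2_set u {..<m} * L2_set v {..<m}"
proof -
  have "\<bar>dot m u v\<bar> \<le> (\<Sum>i<m. \<bar>u i\<bar> * \<bar>v i\<bar>)"
    unfolding dot_def by (rule order_trans[OF sum_abs]) (simp add: abs_mult)
  also have "\<dots> \<le> L2_set u {..<m} * L2_set v {..<m}" by (rule L2_set_mult_ineq)
  finally show ?thesis .
qed

lemma dot_diff_right: "dot m u (\<lambda>i. v i - w i) = dot m u v - dot m u w"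
  by (simp add: dot_def algebra_simps sum_subtractf)

lemma dot_add_unit:
  assumes "i < m"
  shows "dot m u (v(i := v i + e)) = dot m u v + u i * e"
proof -
  have "dot m u (v(i := v i + e)) = (\<Sum>j<m. u j * v j + (if j = i then u i * e else 0))"
    unfolding dot_def by (intro sum.cong) (auto simp: algebra_simps)
  also have "\<dots> = dot m u v + u i * e"
    using assms by (simp add: dot_def sum.distrib)
  finally show ?thesis .
qed

lemma L2_set_Omega_p:
  assumes "p \<in> Omega_p m rbar dlow"
  shows "L2_set p {..<m} \<le> rbar / dlow"
proof -
  have "L2_set p {..<m} \<le> (\<Sum>i<m. p i)"
    by (rule L2_set_le_sum) (use assms in \<open>auto simp: Omega_p_def\<close>)
  then show ?thesis using assms by (auto simp: Omega_p_def)
qed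

lemma coord_le_L2_set: "i < m \<Longrightarrow> \<bar>u i\<bar> \<le> L2_set u {..<m}" for i m :: nat
  using member_le_L2_set[of "{..<m}" i "\<lambda>i. \<bar>u i\<bar>"] by (simp add: L2_set_def)

lemma indicator_accept_set:
  "indicator (accept_set m p) z = (if dot m (snd z) p < fst z then 1 else (0::real))"
  by (simp add: accept_set_def indicator_def)

lemma pred_accept_set [measurable]:
  "Measurable.pred (borel \<Otimes>\<^sub>M vec_borel m) (\<lambda>z. z \<in> accept_set m p)"
  unfolding accept_set_def dot_def mem_Collect_eq by measurable

section \<open>Almost surely bounded arrivals and the law of \<open>r\<close> given
  \<open>a\<close>\<close>

locale bounded_arrivals = prob_space P for P :: "arrival measure" +
  fixes m :: nat and rbar abar :: real
  assumes sets_P [measurable_cong]: "sets P = sets (borel \<Otimes>\<^sub>M vec_borel m)"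
    and bounded: "AE z in P. \<bar>fst z\<bar> \<le> rbar \<and> L2_set (snd z) {..<m} \<le> abar"
begin

text \<open>An almost sure property of a probability space holds at some point, and at such an
  arrival both constants bound a non-negative number.\<close>

lemma bounds_nonneg: "0 \<le> rbar" "0 \<le> abar"
proof -
  obtain z where "\<bar>fst z\<bar> \<le> rbar" "L2_set (snd z) {..<m} \<le> abar"
    using eventually_happens'[OF ae_filter_bot bounded] by auto
  then show "0 \<le> rbar" "0 \<le> abar"
    using L2_set_nonneg[of "snd z" "{..<m}"] by linarith+
qed

lemma measurable_coord [measurable]:
  "i < m \<Longrightarrow> (\<lambda>z. snd z i) \<in> borel_measurable P"
  by measurable

lemma measurable_dot [measurable]: "(\<lambda>z. dot m (snd z) p) \<in> borel_measurable P"
  unfolding dot_def by measurable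

lemma measurable_accept [measurable]:
  "(indicator (accept_set m p) :: _ \<Rightarrow> real) \<in> borel_measurable P"
  by measurable

lemma AE_abs_dot_le: "AE z in P. \<bar>dot m (snd z) p\<bar> \<le> abar * L2_set p {..<m}"
  using bounded
proof eventually_elim
  case (elim z)
  have "L2_set (snd z) {..<m} * L2_set p {..<m} \<le> abar * L2_set p {..<m}"
    using elim by (intro mult_right_mono) auto
  then show ?case using abs_dot_le[of m "snd z" p] by linarith
qed

lemma AE_abs_coord_le: "i < m \<Longrightarrow> AE z in P. \<bar>snd z i\<bar> \<le> abar"
  using bounded by eventually_elim (use coord_le_L2_set order_trans in blast)

lemma integrable_surplus: "integrable P (\<lambda>z. max 0 (fst z - dot m (snd z) p))"
proof (rule integrable_const_bound[where B = "rbar + abar * L2_set p {..<m}"])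
  show "AE z in P. norm (max 0 (fst z - dot m (snd z) p)) \<le> rbar + abar * L2_set p {..<m}"
    using bounded AE_abs_dot_le[of p] by eventually_elim auto
qed measurable

lemma integrable_coord_accept:
  "i < m \<Longrightarrow> integrable P (\<lambda>z. snd z i * indicator (accept_set m p) z)"
proof (rule integrable_const_bound[where B = abar])
  assume "i < m"
  from AE_abs_coord_le[OF this]
  show "AE z in P. norm (snd z i * indicator (accept_set m p) z) \<le> abar"
    by eventually_elim (use bounds_nonneg in \<open>auto simp: indicator_def\<close>)
qed measurable

text \<open>The factor \<open>u (snd z)\<close> is measurable for the sigma-algebra generated by
  \<open>a\<close>, so under the integral both indicators can be replaced by their conditional
  probabilities, to whose difference \<open>lip\<close> applies almost surely.\<close>

lemma integral_accept_diff_le: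
  assumes u: "u \<in> borel_measurable (vec_borel m)"
    and u_le: "AE z in P. \<bar>u (snd z)\<bar> \<le> B"
    and v_le: "AE z in P. \<bar>dot m (snd z) p - dot m (snd z) q\<bar> \<le> D"
    and lip: "AE z in P. \<bar>accept_cond_prob m P p z - accept_cond_prob m P q z\<bar>
                \<le> mu * \<bar>dot m (snd z) p - dot m (snd z) q\<bar>"
    and mu: "0 \<le> mu"
  shows "(\<integral>z. u (snd z) * (indicator (accept_set m p) z - indicator (accept_set m q) z) \<partial>P)
           \<le> B * (mu * D)"
proof -
  define F where "F = vimage_algebra (space P) snd (vec_borel m)"
  have snd_P: "snd \<in> P \<rightarrow>\<^sub>M vec_borel m" by measurable
  have sub: "subalgebra P F"
    unfolding subalgebra_def F_def using sets_image_in_sets[OF refl snd_P] by simp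
  interpret sub: finite_measure_subalgebra P F
    by unfold_locales (rule sub)
  have snd_F: "snd \<in> F \<rightarrow>\<^sub>M vec_borel m"
    unfolding F_def by (rule measurable_vimage_algebra1) (use snd_P in \<open>auto simp: measurable_def\<close>)
  have uF: "(\<lambda>z. u (snd z)) \<in> borel_measurable F"
    by (rule measurable_compose[OF snd_F u])
  have uP [measurable]: "(\<lambda>z. u (snd z)) \<in> borel_measurable P"
    by (rule measurable_compose[OF snd_P u])
  have int: "integrable P (\<lambda>z. u (snd z) * indicator (accept_set m p') z)" for p'
    by (rule integrable_const_bound[where B = B])
       (use u_le in \<open>eventually_elim, auto simp: indicator_def\<close>, measurable)
  let ?G = "\<lambda>p. real_cond_exp P F (indicator (accept_set m p))"
  have G: "?G p' = accept_cond_prob m P p'" for p'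
    by (simp add: accept_cond_prob_def F_def)
  note ce = sub.real_cond_exp_intg[OF int uF measurable_accept]
  have "(\<integral>z. u (snd z) * (indicator (accept_set m p) z - indicator (accept_set m q) z) \<partial>P)
      = (\<integral>z. u (snd z) * ?G p z - u (snd z) * ?G q z \<partial>P)"
    using int ce by (simp add: right_diff_distrib)
  also have "\<dots> \<le> (\<integral>z. B * (mu * D) \<partial>P)"
  proof (rule integral_mono_AE)
    show "AE z in P. u (snd z) * ?G p z - u (snd z) * ?G q z \<le> B * (mu * D)"
      using u_le v_le lip
    proof eventually_elim
      case (elim z)
      have "u (snd z) * ?G p z - u (snd z) * ?G q z \<le> \<bar>u (snd z)\<bar> * \<bar>?G p z - ?G q z\<bar>"
        by (metis abs_ge_self abs_mult right_diff_distrib)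
      also have "\<dots> \<le> B * (mu * D)"
      proof (rule mult_mono)
        have "mu * \<bar>dot m (snd z) p - dot m (snd z) q\<bar> \<le> mu * D"
          using elim mu by (intro mult_left_mono)
        then show "\<bar>?G p z - ?G q z\<bar> \<le> mu * D" using elim unfolding G by linarith
      qed (use elim in auto)
      finally show ?case .
    qed
  qed (use ce in auto)
  finally show ?thesis by (simp add: prob_space)
qed

text \<open>The term \<open>d i\<close> cancels, and what remains is
  \<open>integral_accept_diff_le\<close> with \<open>u a = - a i\<close>, which is bounded by
  \<open>abar\<close>.\<close>

lemma slack_diff_le:
  assumes i: "i < m" and mu: "0 \<le> mu"
    and v_le: "AE z in P. \<bar>dot m (snd z) p - dot m (snd z) q\<bar> \<le> D"
    and lip: "AE z in P. \<bar>accept_cond_prob m P p z - accept_cond_prob m P q z\<bar>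
                \<le> mu * \<bar>dot m (snd z) p - dot m (snd z) q\<bar>"
  shows "slack m P d p i - slack m P d q i \<le> abar * (mu * D)"
proof -
  have "slack m P d p i - slack m P d q i
      = (\<integral>z. - (snd z i) * (indicator (accept_set m p) z - indicator (accept_set m q) z) \<partial>P)"
    using integrable_coord_accept[OF i] by (simp add: slack_def algebra_simps)
  also have "\<dots> \<le> abar * (mu * D)"
    using integral_accept_diff_le[of "\<lambda>a. - a i" abar, OF _ _ v_le lip mu] i AE_abs_coord_le[OF i]
    by simp
  finally show ?thesis .
qed

text \<open>By convexity: \<open>slack m P d p\<close> is a subgradient of the dual objective at \<open>p\<close>.\<close>

lemma dual_obj_add_unit_le:
  fixes q :: "nat \<Rightarrow> real" and e :: real
  assumes i: "i < m"
  defines "p \<equiv> q(i := q i + e)"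
  shows "dual_obj m P d p - dual_obj m P d q \<le> e * slack m P d p i"
proof -
  have "(\<integral>z. max 0 (fst z - dot m (snd z) p) \<partial>P) - (\<integral>z. max 0 (fst z - dot m (snd z) q) \<partial>P)
      = (\<integral>z. max 0 (fst z - dot m (snd z) p) - max 0 (fst z - dot m (snd z) q) \<partial>P)"
    by (simp add: integrable_surplus)
  \<comment> \<open>Pointwise \<open>max 0 y - max 0 x \<le> (y - x) * I(y > 0)\<close>, where
    \<open>x\<close> and \<open>y\<close> are the surpluses at \<open>q\<close> and
    \<open>p\<close>, so that \<open>y - x = - (a_i * e)\<close>.\<close>
  also have "\<dots> \<le> (\<integral>z. - e * (snd z i * indicator (accept_set m p) z) \<partial>P)"
  proof (intro integral_mono Bochner_Integration.integrable_diff integrable_surplus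
      integrable_mult_right integrable_coord_accept i)
    fix z
    show "max 0 (fst z - dot m (snd z) p) - max 0 (fst z - dot m (snd z) q)
        \<le> - e * (snd z i * indicator (accept_set m p) z)"
      using dot_add_unit[OF i, of "snd z" q e, folded p_def]
      by (auto simp: indicator_accept_set mult.commute)
  qed
  finally show ?thesis
    using dot_add_unit[OF i, of d q e, folded p_def]
    by (simp add: dual_obj_def slack_def algebra_simps)
qed

end

subsection \<open>The dual optimum\<close>

text \<open>The one-period loss in reduced reward \<open>r - a^T q\<close> when the arrival is
  judged by the price \<open>p\<close> instead of the optimal price \<open>q\<close>.\<close>

definition price_gap :: "nat \<Rightarrow> (nat \<Rightarrow> real) \<Rightarrow> (nat \<Rightarrow> real) \<Rightarrow> arrival \<Rightarrow> real" where
  "price_gap m q p z = (fst z - dot m (snd z) q) *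
     (indicator (accept_set m q) z - indicator (accept_set m p) z)"

text \<open>Accepting exactly when \<open>r > a^T q\<close> maximizes \<open>(r - a^T q) * x\<close>
  over \<open>x\<close> in \<open>{0, 1}\<close>.\<close>

lemma price_gap_nonneg: "0 \<le> price_gap m q p z"
  by (auto simp: price_gap_def indicator_accept_set)

text \<open>When the two decisions differ, \<open>r\<close> lies between \<open>a^T p\<close> and
  \<open>a^T q\<close>. The factor in front of the indicators then depends on \<open>a\<close> only,
  as \<open>integral_accept_diff_le\<close> requires.\<close>

lemma price_gap_le_dot:
  "price_gap m q p z \<le> dot m (snd z) (\<lambda>i. q i - p i) *
     (indicator (accept_set m p) z - indicator (accept_set m q) z)"
  by (auto simp: price_gap_def indicator_accept_set dot_diff_right)

lemma price_gap_le_abs: "price_gap m q p z \<le> \<bar>fst z - dot m (snd z) q\<bar>"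
  by (auto simp: price_gap_def indicator_accept_set)

locale dual_optimum = bounded_arrivals P m rbar abar
  for P :: "arrival measure" and m rbar abar +
  fixes dlow mu :: real and d q :: "nat \<Rightarrow> real"
  assumes dlow: "0 < dlow" and mu: "0 < mu"
    and d_gt: "\<And>i. i < m \<Longrightarrow> dlow < d i"
    and opt: "dual_opt m P d q"
    and lip: "\<And>p. p \<in> Omega_p m rbar dlow \<Longrightarrow>
      AE z in P. \<bar>accept_cond_prob m P p z - accept_cond_prob m P q z\<bar>
        \<le> mu * \<bar>dot m (snd z) p - dot m (snd z) q\<bar>"
    and comp: "\<And>i. i < m \<Longrightarrow> q i = 0 \<longleftrightarrow> 0 < slack m P d q i"
begin

lemma q_nonneg: "i < m \<Longrightarrow> 0 \<le> q i"
  using opt by (auto simp: dual_opt_def is_arg_min_def)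

lemma dual_obj_q_le: "(\<And>i. i < m \<Longrightarrow> 0 \<le> p i) \<Longrightarrow> dual_obj m P d q \<le> dual_obj m P d p"
  using opt by (auto simp: dual_opt_def is_arg_min_def not_less)

text \<open>Comparison with the price zero: the dual objective there is \<open>E[max 0 r]\<close>,
  and at \<open>q\<close> it is at least \<open>d^T q\<close> because the expected surplus is
  non-negative.\<close>

lemma dot_d_q_le: "dot m d q \<le> rbar"
proof -
  have "dot m d q \<le> dual_obj m P d q" by (simp add: dual_obj_def)
  also have "\<dots> \<le> dual_obj m P d (\<lambda>_. 0)" by (rule dual_obj_q_le) simp
  also have "\<dots> \<le> (\<integral>z. rbar \<partial>P)"
  proof -
    have "AE z in P. max 0 (fst z) \<le> rbar"
      using bounded by eventually_elim auto
    then have "(\<integral>z. max 0 (fst z) \<partial>P) \<le> (\<integral>z. rbar \<partial>P)"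
      using integrable_surplus[of "\<lambda>_. 0"] by (intro integral_mono_AE) (auto simp: dot_def)
    then show ?thesis by (simp add: dual_obj_def dot_def)
  qed
  finally show ?thesis by (simp add: prob_space)
qed

text \<open>Every \<open>d i\<close> exceeds \<open>dlow\<close>, so
  \<open>dlow * (\<Sum>i<m. q i)\<close> is at most \<open>d^T q\<close> and hence at most
  \<open>rbar\<close>.\<close>

lemma q_in_Omega_p: "q \<in> Omega_p m rbar dlow"
proof -
  have "dlow * (\<Sum>i<m. q i) \<le> dot m d q"
    unfolding dot_def sum_distrib_left
    by (intro sum_mono mult_right_mono) (auto simp: q_nonneg d_gt less_imp_le)
  then show ?thesis
    using dot_d_q_le dlow q_nonneg by (auto simp: Omega_p_def field_simps)
qed

text \<open>One positive coordinate of \<open>q\<close> is enough for \<open>dlow < d i\<close> to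
  stay strict after summation.\<close>

lemma sum_q_less:
  assumes "i < m" "0 < q i"
  shows "(\<Sum>i<m. q i) < rbar / dlow"
proof -
  have "dlow * (\<Sum>i<m. q i) < dot m d q"
    unfolding dot_def sum_distrib_left
  proof (rule sum_strict_mono_ex1)
    show "\<forall>i\<in>{..<m}. dlow * q i \<le> d i * q i"
      by (auto intro!: mult_right_mono simp: q_nonneg d_gt less_imp_le)
    show "\<exists>i\<in>{..<m}. dlow * q i < d i * q i"
      using assms d_gt by (intro bexI[of _ i]) auto
  qed simp
  then show ?thesis using dot_d_q_le dlow by (simp add: field_simps)
qed

text \<open>
  The dual objective need not be differentiable, but the slack at \<open>q + e e\<^sub>i\<close> is non-negative by
  convexity, and it tends to the slack at \<open>q\<close> by the Lipschitz bound on the conditional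
  acceptance probability. The strict inequality \<open>sum_q_less\<close> keeps \<open>q + e e\<^sub>i\<close> in \<open>Omega_p\<close>.
\<close>

lemma slack_nonneg:
  assumes i: "i < m" and qi: "0 < q i"
  shows "0 \<le> slack m P d q i"
proof (rule ccontr)
  assume "\<not> 0 \<le> slack m P d q i"
  define s where "s = - slack m P d q i"
  define c where "c = abar * (mu * abar)"
  \<comment> \<open>The first bound keeps \<open>p\<close> in \<open>Omega_p\<close>. The second
    gives \<open>c * e < s\<close>, where \<open>c * e\<close> bounds the increase of the slack from
    \<open>q\<close> to \<open>p\<close>, so that the slack at \<open>p\<close> is still negative.
    Adding 1 to \<open>c\<close> avoids a division by zero and makes the inequality strict.\<close>
  define e where "e = min (rbar / dlow - (\<Sum>i<m. q i)) (s / (c + 1))"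
  define p where "p = q(i := q i + e)"
  have s: "0 < s" using \<open>\<not> 0 \<le> _\<close> by (simp add: s_def)
  have c: "0 \<le> c" using mu bounds_nonneg by (simp add: c_def)
  have e: "0 < e" using s c sum_q_less[OF i qi] by (simp add: e_def)
  have dot_p: "dot m u p = dot m u q + u i * e" for u
    unfolding p_def by (rule dot_add_unit[OF i])
  have "(\<Sum>j<m. p j) = (\<Sum>j<m. q j) + e"
    using dot_p[of "\<lambda>_. 1"] by (simp add: dot_def)
  also have "\<dots> \<le> rbar / dlow" by (simp add: e_def min_def)
  finally have "p \<in> Omega_p m rbar dlow"
    using e q_nonneg by (auto simp: Omega_p_def p_def)
  moreover have "AE z in P. \<bar>dot m (snd z) p - dot m (snd z) q\<bar> \<le> abar * e"
    using AE_abs_coord_le[OF i]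
    by eventually_elim (use e in \<open>auto simp: dot_p abs_mult intro!: mult_right_mono\<close>)
  ultimately have "slack m P d p i - slack m P d q i \<le> abar * (mu * (abar * e))"
    using mu by (intro slack_diff_le[OF i] lip) auto
  then have 1: "slack m P d p i + s \<le> c * e" by (simp add: c_def s_def algebra_simps)
  have "dual_obj m P d q \<le> dual_obj m P d p"
    by (rule dual_obj_q_le) (use e q_nonneg in \<open>auto simp: p_def add_nonneg_nonneg less_imp_le\<close>)
  \<comment> \<open>Optimality of \<open>q\<close> makes the left-hand side of the subgradient
    inequality non-negative, which is incompatible with a negative slack at
    \<open>p\<close>.\<close>
  then have "0 \<le> e * slack m P d p i"
    using dual_obj_add_unit_le[OF i, of d q e] by (simp add: p_def)
  then have 2: "0 \<le> slack m P d p i" using e by (simp add: zero_le_mult_iff)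
  have "e \<le> s / (c + 1)" by (simp add: e_def)
  then have "(c + 1) * e \<le> s" using c by (simp add: pos_le_divide_eq mult.commute)
  then show False using 1 2 e by (simp add: algebra_simps)
qed

text \<open>The condition \<open>comp\<close> by itself leaves open a positive price with negative
  slack; \<open>slack_nonneg\<close> excludes it. This is complementary slackness.\<close>

lemma q_eq_0_if_not_binding: "i < m \<Longrightarrow> i \<notin> binding m P d q \<Longrightarrow> q i = 0"
  using comp[of i] slack_nonneg[of i] q_nonneg[of i] by (force simp: binding_def)

lemma measurable_price_gap [measurable]: "price_gap m q p \<in> borel_measurable P"
  unfolding price_gap_def by measurable

abbreviation "surplus_bound \<equiv> rbar + abar * (rbar / dlow)"

text \<open>Cauchy-Schwarz, with the norm of \<open>q\<close> at most \<open>rbar / dlow\<close>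
  because \<open>q\<close> lies in \<open>Omega_p\<close>.\<close>

lemma abs_surplus_le:
  assumes "\<bar>fst z\<bar> \<le> rbar" "L2_set (snd z) {..<m} \<le> abar"
  shows "\<bar>fst z - dot m (snd z) q\<bar> \<le> surplus_bound"
proof -
  have "L2_set (snd z) {..<m} * L2_set q {..<m} \<le> abar * (rbar / dlow)"
    using assms L2_set_Omega_p[OF q_in_Omega_p] bounds_nonneg by (intro mult_mono) auto
  then show ?thesis using abs_dot_le[of m "snd z" q] assms by linarith
qed

text \<open>The bound is quadratic because one factor \<open>abar * ?l\<close> comes from the size
  of \<open>a^T (q - p)\<close> and another from the Lipschitz bound on the conditional acceptance
  probability. The left-hand side is a non-negative integral, to serve as the inner integral over
  the product space.\<close>

lemma nn_integral_price_gap_le: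
  assumes p: "p \<in> Omega_p m rbar dlow"
  shows "(\<integral>\<^sup>+z. ennreal (price_gap m q p z) \<partial>P)
    \<le> ennreal (mu * abar\<^sup>2 * (L2_set (\<lambda>i. p i - q i) {..<m})\<^sup>2)"
proof -
  let ?l = "L2_set (\<lambda>i. p i - q i) {..<m}"
  have sym: "L2_set (\<lambda>i. q i - p i) {..<m} = ?l"
    by (simp add: L2_set_def power2_commute)
  have int: "integrable P (price_gap m q p)"
  proof (rule integrable_const_bound[where B = surplus_bound])
    show "AE z in P. norm (price_gap m q p z) \<le> surplus_bound"
      using bounded
    proof eventually_elim
      case (elim z)
      then show ?case
        using abs_surplus_le[of z] price_gap_le_abs[of m q p z] price_gap_nonneg[of m q p z] by simp
    qed
  qed measurable
  have meas: "(\<lambda>a. dot m a (\<lambda>i. q i - p i)) \<in> borel_measurable (vec_borel m)"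
    unfolding dot_def by measurable
  have *: "AE z in P. \<bar>dot m (snd z) (\<lambda>i. q i - p i)\<bar> \<le> abar * ?l"
    using AE_abs_dot_le[of "\<lambda>i. q i - p i"] by (simp add: sym)
  have **: "AE z in P. \<bar>dot m (snd z) p - dot m (snd z) q\<bar> \<le> abar * ?l"
    using AE_abs_dot_le[of "\<lambda>i. p i - q i"] by (simp add: dot_diff_right)
  have "(\<integral>z. price_gap m q p z \<partial>P) \<le> (\<integral>z. dot m (snd z) (\<lambda>i. q i - p i) *
     (indicator (accept_set m p) z - indicator (accept_set m q) z) \<partial>P)"
  proof (intro integral_mono int price_gap_le_dot)
    show "integrable P (\<lambda>z. dot m (snd z) (\<lambda>i. q i - p i) *
     (indicator (accept_set m p) z - indicator (accept_set m q) z))"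
      by (rule integrable_const_bound[where B = "abar * ?l"])
         (use * in \<open>eventually_elim, auto simp: indicator_def\<close>, measurable)
  qed
  also have "\<dots> \<le> (abar * ?l) * (mu * (abar * ?l))"
    using integral_accept_diff_le[OF meas * ** lip[OF p]] mu by simp
  finally show ?thesis
    using int price_gap_nonneg
    by (subst nn_integral_eq_integral) (auto simp: power2_eq_square algebra_simps intro!: ennreal_leI)
qed

end

subsection \<open>Sample paths of a dual-based policy\<close>

lemma history_eq:
  "j \<in> {1..t} \<Longrightarrow> history m b h w t j = (fst (w j), snd (w j), decision m b h w j)"
proof (induction t)
  case (Suc t)
  then show ?case by (cases "j = Suc t") (auto simp: Let_def decision_def)
qed simp

lemma remaining_eq_sum: "remaining m b h w t i = b i - (\<Sum>j=1..t. snd (w j) i * decision m b h w j)"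
  by (induction t) auto

text \<open>The consumption summed up in \<open>decide\<close> is the initial minus the remaining
  capacity, so the check compares one arrival with what remains.\<close>

lemma decision_Suc:
  "decision m b h w (Suc t) =
     (let x = indicator (accept_set m (price m b h w (Suc t))) (w (Suc t))
      in if \<forall>i<m. snd (w (Suc t)) i * x \<le> remaining m b h w t i then x else 0)"
proof -
  have eq: "decision m b h w (Suc t)
      = decide m b (Suc t) (history m b h w t) (price m b h w (Suc t)) (w (Suc t))"
    by (simp add: decision_def price_def Let_def)
  have used: "(\<Sum>j\<in>{1..<Suc t}. fst (snd (history m b h w t j)) i * snd (snd (history m b h w t j)))
      = b i - remaining m b h w t i" for i
    unfolding remaining_eq_sum
    by (auto intro!: sum.cong simp: history_eq atLeastLessThanSuc_atLeastAtMost)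
  have le_iff: "x - y + z \<le> x \<longleftrightarrow> z \<le> y" for x y z :: real
    by linarith
  show ?thesis
    unfolding eq decide_def used le_iff ..
qed

lemma decision_cases: "1 \<le> t \<Longrightarrow> decision m b h w t = 0 \<or> decision m b h w t = 1"
  by (cases t) (auto simp: decision_Suc Let_def indicator_def)

text \<open>An accepted arrival fits into the remaining capacity in every coordinate, and a rejected
  one consumes nothing.\<close>

lemma remaining_nonneg:
  assumes "\<And>i. i < m \<Longrightarrow> 0 \<le> b i" "i < m"
  shows "0 \<le> remaining m b h w t i"
  using assms(2)
proof (induction t)
  case (Suc t)
  then show ?case by (auto simp: decision_Suc Let_def)
qed (simp add: assms)

text \<open>No coordinate of \<open>a\<close> exceeds its Euclidean norm, so capacity
  \<open>s\<close> everywhere lets the check pass.\<close>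

lemma decision_eq_indicator:
  assumes "\<And>i. i < m \<Longrightarrow> s \<le> remaining m b h w t i" "L2_set (snd (w (Suc t))) {..<m} \<le> s"
  shows "decision m b h w (Suc t) =
    indicator (accept_set m (price m b h w (Suc t))) (w (Suc t))"
proof -
  have "0 \<le> s" using assms(2) L2_set_nonneg order_trans by blast
  have "snd (w (Suc t)) i \<le> remaining m b h w t i" "0 \<le> remaining m b h w t i" if "i < m" for i
    using coord_le_L2_set[OF that, of "snd (w (Suc t))"] assms(1)[OF that] assms(2) \<open>0 \<le> s\<close>
    by linarith+
  then show ?thesis by (auto simp: decision_Suc Let_def indicator_def)
qed

section \<open>Prices and stopping depend on past arrivals only\<close>

lemma history_cong:
  "(\<And>j. j \<in> {1..t} \<Longrightarrow> w j = w' j) \<Longrightarrow> history m b h w t = history m b h w' t"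
  by (induction t) (auto simp: Let_def)

lemma remaining_cong:
  assumes "\<And>j. j \<in> {1..t} \<Longrightarrow> w j = w' j"
  shows "remaining m b h w t i = remaining m b h w' t i"
proof -
  have "decision m b h w j = decision m b h w' j" if "j \<in> {1..t}" for j
    unfolding decision_def using that assms by (subst history_cong[of j w w']) auto
  then show ?thesis by (simp add: remaining_eq_sum assms)
qed

text \<open>The price of period \<open>t\<close> is computed from the periods up to
  \<open>t - 1\<close>. This is the form in which its independence of the arrival \<open>t\<close>
  is used.\<close>

lemma price_fun_upd: "1 \<le> t \<Longrightarrow> price m b h (w(t := z)) t = price m b h w t"
  unfolding price_def by (subst history_cong[of "t - 1" "w(t := z)" w]) auto

text \<open>The event that period \<open>t\<close> is not after the stopping time, written so that
  it visibly depends on earlier arrivals only. The range of \<open>k\<close> starts at 1, as in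
  \<open>stop_time\<close>.\<close>

definition active ::
    "nat \<Rightarrow> (nat \<Rightarrow> real) \<Rightarrow> (nat \<Rightarrow> hist \<Rightarrow> nat \<Rightarrow> real) \<Rightarrow> real \<Rightarrow> (nat \<Rightarrow> arrival) \<Rightarrow> nat \<Rightarrow> bool" where
  "active m b h s w t \<longleftrightarrow> (\<forall>k\<in>{1..<t}. \<forall>i\<in>{..<m}. s \<le> remaining m b h w k i)"

lemma active_fun_upd: "active m b h s (w(t := z)) t = active m b h s w t"
  unfolding active_def by (intro ball_cong refl) (subst remaining_cong[of _ _ w], auto)

text \<open>A number is at most the infimum iff it is at most every member of the set. The member
  \<open>n\<close> imposes nothing since \<open>t \<le> n\<close>, and \<open>0 < m\<close> makes
  the minimum one over a non-empty set.\<close>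

lemma le_stop_time_iff:
  assumes "0 < m" "t \<le> n"
  shows "t \<le> stop_time m n b h s w \<longleftrightarrow> active m b h s w t"
proof -
  have "t \<le> stop_time m n b h s w \<longleftrightarrow>
    (\<forall>k\<in>{n} \<union> {t. 1 \<le> t \<and> Min ((\<lambda>i. remaining m b h w t i) ` {..<m}) < s}. t \<le> k)"
    unfolding stop_time_def by (rule le_cInf_iff) auto
  also have "\<dots> \<longleftrightarrow> (\<forall>k\<in>{1..<t}. \<not> Min ((\<lambda>i. remaining m b h w k i) ` {..<m}) < s)"
    using assms(2) by (auto simp: not_le[symmetric])
  also have "\<dots> \<longleftrightarrow> active m b h s w t"
    unfolding active_def not_less using assms(1) by (subst Min_ge_iff) auto
  finally show ?thesis .
qed

lemma stop_time_le: "stop_time m n b h s w \<le> n"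
  unfolding stop_time_def by (rule cInf_lower) auto

text \<open>Weak duality: \<open>q\<close> prices the capacities, and the positive part of
  \<open>r_t - a_t^T q\<close> is the multiplier of \<open>x_t \<le> 1\<close>.\<close>

lemma lp_value_le:
  assumes "\<And>i. i < m \<Longrightarrow> 0 \<le> b i" "\<And>i. i < m \<Longrightarrow> 0 \<le> q i"
  shows "lp_value m n b w \<le> dot m b q + (\<Sum>t=1..n. max 0 (fst (w t) - dot m (snd (w t)) q))"
  unfolding lp_value_def
proof (rule cSUP_least)
  show "lp_feasible m n b w \<noteq> {}"
    \<comment> \<open>Rejecting everything is feasible since \<open>b\<close> is non-negative; the
      supremum bound needs a non-empty set.\<close>
    using assms by (auto simp: lp_feasible_def intro!: exI[of _ "\<lambda>_. 0"])
next
  fix x assume x: "x \<in> lp_feasible m n b w"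
  have "(\<Sum>t=1..n. dot m (snd (w t)) q * x t) = dot m (\<lambda>i. \<Sum>t=1..n. snd (w t) i * x t) q"
    unfolding dot_def sum_distrib_right by (subst sum.swap) (simp add: algebra_simps)
  also have "\<dots> \<le> dot m b q"
    unfolding dot_def using x assms by (intro sum_mono mult_right_mono) (auto simp: lp_feasible_def)
  finally have 1: "(\<Sum>t=1..n. dot m (snd (w t)) q * x t) \<le> dot m b q" .
  have "(\<Sum>t=1..n. (fst (w t) - dot m (snd (w t)) q) * x t)
      \<le> (\<Sum>t=1..n. max 0 (fst (w t) - dot m (snd (w t)) q))"
  proof (rule sum_mono)
    fix t assume "t \<in> {1..n}"
    then have xt: "0 \<le> x t" "x t \<le> 1" using x by (auto simp: lp_feasible_def)
    let ?s = "fst (w t) - dot m (snd (w t)) q"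
    have "?s * x t \<le> max 0 ?s * x t" using xt by (intro mult_right_mono) auto
    also have "\<dots> \<le> max 0 ?s" using xt by (intro mult_left_le) auto
    finally show "?s * x t \<le> max 0 ?s" .
  qed
  with 1 show "(\<Sum>j=1..n. fst (w j) * x j)
    \<le> dot m b q + (\<Sum>t=1..n. max 0 (fst (w t) - dot m (snd (w t)) q))"
    by (simp add: algebra_simps sum_subtractf)
qed

text \<open>Add and subtract \<open>a_t^T q\<close> in every period; the total consumption is
  \<open>b\<close> minus the final remaining capacity.\<close>

lemma revenue_eq:
  "revenue m n b h w = dot m b q - dot m (remaining m b h w n) q
     + (\<Sum>t=1..n. (fst (w t) - dot m (snd (w t)) q) * decision m b h w t)"
proof -
  have "(\<Sum>t=1..n. dot m (snd (w t)) q * decision m b h w t)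
      = dot m (\<lambda>i. \<Sum>t=1..n. snd (w t) i * decision m b h w t) q"
    unfolding dot_def sum_distrib_right by (subst sum.swap) (simp add: algebra_simps)
  also have "\<dots> = dot m b q - dot m (remaining m b h w n) q"
    by (simp add: dot_def remaining_eq_sum left_diff_distrib sum_subtractf)
  finally show ?thesis
    by (simp add: revenue_def algebra_simps sum_subtractf)
qed

section \<open>Measurability of a decision in history, price and arrival\<close>

lemma measurable_decide:
  assumes H: "H \<in> N \<rightarrow>\<^sub>M PiM {1..<t} (\<lambda>_. borel \<Otimes>\<^sub>M vec_borel m \<Otimes>\<^sub>M borel)"
    and p: "p \<in> N \<rightarrow>\<^sub>M vec_borel m" and z: "z \<in> N \<rightarrow>\<^sub>M borel \<Otimes>\<^sub>M vec_borel m"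
  shows "(\<lambda>w. decide m b t (H w) (p w) (z w)) \<in> borel_measurable N"
proof -
  have coord: "(\<lambda>w. f w i) \<in> borel_measurable N" if "f \<in> N \<rightarrow>\<^sub>M vec_borel m" "i < m" for f i
    by (rule measurable_compose[OF that(1) measurable_component_singleton]) (use that in simp)
  have z1: "(\<lambda>w. fst (z w)) \<in> borel_measurable N" and z2: "(\<lambda>w. snd (z w)) \<in> N \<rightarrow>\<^sub>M vec_borel m"
    by (rule measurable_compose[OF z measurable_fst], rule measurable_compose[OF z measurable_snd])
  have used: "(\<lambda>w. \<Sum>j\<in>{1..<t}. fst (snd (H w j)) i * snd (snd (H w j))) \<in> borel_measurable N"
    if "i < m" for i
  proof (rule borel_measurable_sum)
    fix j assume "j \<in> {1..<t}"
    then have Hj: "(\<lambda>w. H w j) \<in> N \<rightarrow>\<^sub>M borel \<Otimes>\<^sub>M vec_borel m \<Otimes>\<^sub>M borel"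
      by (rule measurable_compose[OF H measurable_component_singleton])
    note Hj' = measurable_compose[OF Hj measurable_snd]
    show "(\<lambda>w. fst (snd (H w j)) i * snd (snd (H w j))) \<in> borel_measurable N"
      by (rule borel_measurable_times[OF coord[OF measurable_compose[OF Hj' measurable_fst] that]
          measurable_compose[OF Hj' measurable_snd]])
  qed
  have dot: "(\<lambda>w. dot m (snd (z w)) (p w)) \<in> borel_measurable N"
    unfolding dot_def
    by (rule borel_measurable_sum, rule borel_measurable_times) (auto intro: coord[OF z2] coord[OF p])
  \<comment> \<open>The price varies with \<open>w\<close>, so acceptance is treated as a comparison
    of two measurable functions rather than as membership in a fixed set.\<close>
  have acc: "(\<lambda>w. indicator (accept_set m (p w)) (z w) :: real) \<in> borel_measurable N"
    unfolding indicator_accept_set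
    by (rule measurable_If[OF _ _ borel_measurable_less[OF dot z1]]) auto
  have le: "Measurable.pred N (\<lambda>w. f w + g w * k w \<le> c)"
    if [measurable]: "f \<in> borel_measurable N" "g \<in> borel_measurable N" "k \<in> borel_measurable N"
    for f g k :: "_ \<Rightarrow> real" and c
    by measurable
  have "Measurable.pred N (\<lambda>w. \<forall>i\<in>{..<m}.
      (\<Sum>j\<in>{1..<t}. fst (snd (H w j)) i * snd (snd (H w j)))
        + snd (z w) i * indicator (accept_set m (p w)) (z w) \<le> b i)"
    by (rule pred_intros_finite(3)[OF finite_lessThan], rule le[OF used coord[OF z2] acc])
       (simp_all only: lessThan_iff)
  then have "{w \<in> space N. \<forall>i<m. (\<Sum>j\<in>{1..<t}. fst (snd (H w j)) i * snd (snd (H w j)))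
        + snd (z w) i * indicator (accept_set m (p w)) (z w) \<le> b i} \<in> sets N"
    unfolding pred_def Ball_def lessThan_iff .
  from measurable_If[OF acc borel_measurable_const[of 0] this]
  show ?thesis unfolding decide_def Let_def .
qed

section \<open>The regret of a policy on a sample path\<close>

locale online_policy = dual_optimum P m rbar abar dlow mu d q
  for P :: "arrival measure" and m rbar abar dlow mu d q +
  fixes n :: nat and b :: "nat \<Rightarrow> real" and h :: "nat \<Rightarrow> hist \<Rightarrow> nat \<Rightarrow> real"
  assumes m_pos: "0 < m" and m_less_n: "m < n"
    and d_eq: "d = (\<lambda>i. b i / real n)"
    and policy: "dual_policy m n h"
    and prices: "AE w in sample n P. \<forall>t\<in>{1..stop_time m n b h abar w}.
      price m b h w t \<in> Omega_p m rbar dlow"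
begin

abbreviation "\<tau> \<equiv> stop_time m n b h abar"
abbreviation "act \<equiv> active m b h abar"
abbreviation "rem \<equiv> remaining m b h"
abbreviation "pr \<equiv> price m b h"
abbreviation "dec \<equiv> decision m b h"

lemma b_nonneg: "i < m \<Longrightarrow> 0 \<le> b i"
proof -
  assume "i < m"
  then have "0 < b i / real n" using d_gt[of i] dlow by (simp add: d_eq)
  then show "0 \<le> b i" by (simp add: zero_less_divide_iff)
qed

lemma surplus_bound_nonneg: "0 \<le> surplus_bound"
  using bounds_nonneg dlow by simp

text \<open>The price \<open>q\<close> vanishes off the binding set and is at most
  \<open>rbar / dlow\<close> on it, while the remaining capacities are non-negative.\<close>

lemma dot_remaining_q_le:
  "dot m (rem w n) q \<le> rbar / dlow * (\<Sum>i\<in>binding m P d q. rem w n i)"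
proof -
  have "dot m (rem w n) q = (\<Sum>i\<in>binding m P d q. rem w n i * q i)"
    unfolding dot_def
    by (intro sum.mono_neutral_right) (auto simp: binding_def dest: q_eq_0_if_not_binding[unfolded binding_def])
  also have "\<dots> \<le> (\<Sum>i\<in>binding m P d q. rbar / dlow * rem w n i)"
  proof (rule sum_mono)
    fix i assume "i \<in> binding m P d q"
    then have i: "i < m" by (simp add: binding_def)
    have "q i \<le> rbar / dlow"
      using coord_le_L2_set[OF i, of q] L2_set_Omega_p[OF q_in_Omega_p] by linarith
    then show "rem w n i * q i \<le> rbar / dlow * rem w n i"
      using remaining_nonneg[OF b_nonneg i, where h = h and w = w and t = n]
      by (subst mult.commute) (rule mult_right_mono)
  qed
  finally show ?thesis by (simp add: sum_distrib_left)
qed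

text \<open>
  Before \<open>\<tau>\<close> the capacity check can fail only in period 1, because the definition of \<open>\<tau>\<close> ignores the
  initial capacity. In that case nothing is consumed, so \<open>\<tau> = 1\<close> and the loss is charged to \<open>n - \<tau>\<close>.
\<close>

lemma decision_eq_or_stop_time:
  assumes bnd: "\<And>t. t \<in> {1..n} \<Longrightarrow> L2_set (snd (w t)) {..<m} \<le> abar" and t: "t \<in> {1..\<tau> w}"
  shows "dec w t = indicator (accept_set m (pr w t)) (w t) \<or> \<tau> w = 1"
proof (rule ccontr)
  assume neg: "\<not> ?thesis"
  obtain k where k: "t = Suc k" using t by (cases t) auto
  have tn: "t \<le> n" using t stop_time_le[of m n b h abar w] by simp
  have not_ge: "\<exists>i<m. rem w k i < abar"
    using decision_eq_indicator[of m abar b h w k] neg bnd[of t] t tn by (force simp: k not_le[symmetric])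
  \<comment> \<open>Activity at \<open>t\<close> guarantees capacity \<open>abar\<close> after each
    of the periods \<open>1\<close> to \<open>t - 1\<close>, so the shortage after period
    \<open>k\<close> is possible only for \<open>k = 0\<close>.\<close>
  have "act w t" using le_stop_time_iff[OF m_pos tn] t by simp
  then have "k \<notin> {1..<t}" using not_ge unfolding active_def by (meson lessThan_iff not_le)
  then have "k = 0" using k by auto
  have "2 \<le> \<tau> w" using neg t by auto
  then have "act w 2"
    using le_stop_time_iff[OF m_pos, of 2 n] m_pos m_less_n by simp
  have "abar \<le> rem w 1 i" if "i < m" for i
    by (rule \<open>act w 2\<close>[unfolded active_def, rule_format]) (use that in auto)
  \<comment> \<open>A decision that differs from the indicator is a rejection, so the capacity after
    period 1 is the initial one: sufficient by \<open>act w 2\<close>, yet short by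
    \<open>not_ge\<close>.\<close>
  moreover have "dec w (Suc 0) = 0"
    using neg by (auto simp: k \<open>k = 0\<close> decision_Suc Let_def split: if_splits)
  then have "rem w 1 i = rem w k i" for i by (simp add: \<open>k = 0\<close>)
  ultimately show False using not_ge by (metis not_le)
qed

text \<open>The factor 2 has two sources: the periods after the stopping time, and the first period
  in the case \<open>\<tau> w = 1\<close>, where its capacity check may fail.\<close>

lemma regret_le:
  assumes bnd: "\<And>t. t \<in> {1..n} \<Longrightarrow> \<bar>fst (w t)\<bar> \<le> rbar \<and> L2_set (snd (w t)) {..<m} \<le> abar"
  shows "lp_value m n b w - revenue m n b h w
    \<le> (\<Sum>t=1..\<tau> w. price_gap m q (pr w t) (w t))
      + 2 * surplus_bound * (real n - real (\<tau> w))
      + rbar / dlow * (\<Sum>i\<in>binding m P d q. rem w n i)"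
proof -
  define s where "s t = fst (w t) - dot m (snd (w t)) q" for t
  define T where "T t = max 0 (s t) - s t * dec w t" for t
  have T_le: "T t \<le> surplus_bound" if "t \<in> {1..n}" for t
    using abs_surplus_le[of "w t"] bnd[OF that] decision_cases[of t m b h w] that
    by (auto simp: T_def s_def)
  have "(\<Sum>t=1..\<tau> w. T t) \<le> (\<Sum>t=1..\<tau> w. price_gap m q (pr w t) (w t))
      + surplus_bound * (real n - real (\<tau> w))"
  proof (cases "\<tau> w = 1")
    \<comment> \<open>Since \<open>0 < m < n\<close>, the number \<open>n - 1\<close> is at least 1,
      so the loss of the only period up to the stopping time is covered whatever its decision
      was.\<close>
    case True
    have "T 1 \<le> surplus_bound" using m_less_n by (intro T_le) auto
    also have "\<dots> \<le> surplus_bound * (real n - 1)"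
      using mult_left_mono[OF _ surplus_bound_nonneg, of 1 "real n - 1"] m_pos m_less_n by simp
    finally show ?thesis using True price_gap_nonneg[of m q "pr w 1" "w 1"] by simp
  next
    case False
    \<comment> \<open>The positive part of \<open>s t\<close> is \<open>s t\<close> times the
      indicator of acceptance at \<open>q\<close>, so an unobstructed decision loses exactly the
      price gap.\<close>
    have "T t = price_gap m q (pr w t) (w t)" if "t \<in> {1..\<tau> w}" for t
    proof -
      have "dec w t = indicator (accept_set m (pr w t)) (w t)"
        using decision_eq_or_stop_time[OF _ that] bnd False by blast
      then show ?thesis
        by (auto simp: T_def price_gap_def indicator_accept_set s_def)
    qed
    moreover have "0 \<le> surplus_bound * (real n - real (\<tau> w))"
      using surplus_bound_nonneg stop_time_le[of m n b h abar w] by (intro mult_nonneg_nonneg) auto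
    ultimately show ?thesis by simp
  qed
  moreover have "(\<Sum>t\<in>{\<tau> w<..n}. T t) \<le> surplus_bound * (real n - real (\<tau> w))"
  proof -
    have "(\<Sum>t\<in>{\<tau> w<..n}. T t) \<le> of_nat (card {\<tau> w<..n}) * surplus_bound"
      by (rule sum_bounded_above) (rule T_le, auto)
    then show ?thesis using stop_time_le[of m n b h abar w] by (simp add: of_nat_diff mult.commute)
  qed
  moreover have "(\<Sum>t=1..n. T t) = (\<Sum>t=1..\<tau> w. T t) + (\<Sum>t\<in>{\<tau> w<..n}. T t)"
    using stop_time_le[of m n b h abar w]
    by (subst sum.union_disjoint[symmetric]) (auto intro!: sum.cong)
  moreover have "lp_value m n b w - revenue m n b h w
      \<le> (\<Sum>t=1..n. T t) + dot m (rem w n) q"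
    using lp_value_le[of m b q n w, OF b_nonneg q_nonneg] revenue_eq[of m n b h w q]
    by (simp add: T_def s_def sum_subtractf)
  ultimately show ?thesis using dot_remaining_q_le[of w] by linarith
qed

section \<open>Measurability and integrability under the product law\<close>

lemma measurable_sample_component:
  assumes "t \<in> {1..n}"
  shows "(\<lambda>w. w t) \<in> sample n P \<rightarrow>\<^sub>M borel \<Otimes>\<^sub>M vec_borel m"
  using measurable_component_singleton[OF assms, of "\<lambda>_. P"] sets_P measurable_cong_sets by blast

lemma measurable_history:
  assumes "t \<le> n"
  shows "(\<lambda>w. history m b h w t) \<in> sample n P \<rightarrow>\<^sub>M
    PiM {1..<Suc t} (\<lambda>_. borel \<Otimes>\<^sub>M vec_borel m \<Otimes>\<^sub>M borel)"
  using assms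
proof (induction t)
  case 0
  \<comment> \<open>The product over the empty index set has one point, the function that is
    constantly \<open>undefined\<close>, and this is the empty history.\<close>
  show ?case by (auto simp: space_PiM_empty)
next
  case (Suc t)
  note H = Suc.IH[OF Suc_leD[OF Suc.prems]]
  have w: "(\<lambda>w. w (Suc t)) \<in> sample n P \<rightarrow>\<^sub>M borel \<Otimes>\<^sub>M vec_borel m"
    using Suc.prems by (intro measurable_sample_component) auto
  have "h (Suc t) \<in> PiM {1..<Suc t} (\<lambda>_. borel \<Otimes>\<^sub>M vec_borel m \<Otimes>\<^sub>M borel) \<rightarrow>\<^sub>M vec_borel m"
    using policy Suc.prems by (auto simp: dual_policy_def)
  from measurable_decide[OF H measurable_compose[OF H this] w]
  have dec: "(\<lambda>w. decide m b (Suc t) (history m b h w t)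
      (h (Suc t) (history m b h w t)) (w (Suc t))) \<in> borel_measurable (sample n P)" .
  show ?case
    unfolding history.simps Let_def
    by (rule measurable_fun_upd[OF _ H measurable_Pair[OF measurable_compose[OF w measurable_fst]
          measurable_Pair[OF measurable_compose[OF w measurable_snd] dec]]]) auto
qed

lemma measurable_price:
  assumes "t \<in> {1..n}"
  shows "(\<lambda>w. pr w t) \<in> sample n P \<rightarrow>\<^sub>M vec_borel m"
proof -
  have "h t \<in> PiM {1..<t} (\<lambda>_. borel \<Otimes>\<^sub>M vec_borel m \<Otimes>\<^sub>M borel) \<rightarrow>\<^sub>M vec_borel m"
    using policy assms by (auto simp: dual_policy_def)
  moreover have "(\<lambda>w. history m b h w (t - 1)) \<in> sample n P \<rightarrow>\<^sub>M
    PiM {1..<t} (\<lambda>_. borel \<Otimes>\<^sub>M vec_borel m \<Otimes>\<^sub>M borel)"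
    using measurable_history[of "t - 1"] assms by auto
  ultimately show ?thesis unfolding price_def by (rule measurable_compose[rotated])
qed

lemma measurable_decision:
  assumes "t \<in> {1..n}"
  shows "(\<lambda>w. dec w t) \<in> borel_measurable (sample n P)"
proof -
  have [measurable]: "(\<lambda>w. history m b h w t t) \<in> sample n P \<rightarrow>\<^sub>M borel \<Otimes>\<^sub>M vec_borel m \<Otimes>\<^sub>M borel"
    using assms by (intro measurable_compose[OF measurable_history[of t] measurable_component_singleton]) auto
  show ?thesis unfolding decision_def by measurable
qed

lemma measurable_consumption:
  assumes "t \<in> {1..n}" "i < m"
  shows "(\<lambda>w. snd (w t) i * dec w t) \<in> borel_measurable (sample n P)"
  by (rule borel_measurable_times[OF measurable_compose[OF measurable_compose[OF
        measurable_sample_component measurable_snd] measurable_component_singleton]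
      measurable_decision]) (use assms in auto)

lemma measurable_remaining:
  assumes "t \<le> n" "i < m"
  shows "(\<lambda>w. rem w t i) \<in> borel_measurable (sample n P)"
  unfolding remaining_eq_sum
  using assms by (intro borel_measurable_diff borel_measurable_sum measurable_consumption) auto

lemma measurable_active:
  assumes "t \<le> n"
  shows "Measurable.pred (sample n P) (\<lambda>w. act w t)"
  unfolding active_def
  by (intro pred_intros_finite(3) finite_lessThan finite_atLeastLessThan, unfold pred_def,
      rule borel_measurable_le[OF borel_measurable_const measurable_remaining])
     (use assms in auto)

lemma prob_space_sample: "prob_space (sample n P)"
  by (intro prob_space_PiM prob_space_axioms)

lemma AE_sample:
  "AE w in sample n P. \<forall>t\<in>{1..n}. \<bar>fst (w t)\<bar> \<le> rbar \<and> L2_set (snd (w t)) {..<m} \<le> abar"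
  by (rule AE_finite_allI[OF finite_atLeastAtMost],
      rule AE_PiM_component[where M = "\<lambda>_. P", OF prob_space_axioms _ bounded])

lemma integrable_remaining:
  assumes "i < m"
  shows "integrable (sample n P) (\<lambda>w. rem w n i)"
proof -
  interpret S: prob_space "sample n P" by (rule prob_space_sample)
  have "integrable (sample n P) (\<lambda>w. snd (w t) i * dec w t)" if t: "t \<in> {1..n}" for t
  proof (rule S.integrable_const_bound[where B = abar])
    show "AE w in sample n P. norm (snd (w t) i * dec w t) \<le> abar"
      using AE_sample
    proof eventually_elim
      case (elim w)
      then show ?case
        using coord_le_L2_set[OF assms, of "snd (w t)"] t decision_cases[of t m b h w] bounds_nonneg
        by fastforce
    qed
  qed (rule measurable_consumption[OF t assms])
  then show ?thesis
    unfolding remaining_eq_sum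
    by (intro Bochner_Integration.integrable_diff Bochner_Integration.integrable_sum
        S.integrable_const)
qed

subsection \<open>Expected regret\<close>

abbreviation "dist2 w t \<equiv> (L2_set (\<lambda>i. pr w t i - q i) {..<m})\<^sup>2"
abbreviation "gap w t \<equiv> price_gap m q (pr w t) (w t)"

lemma measurable_price_coord:
  assumes "t \<in> {1..n}" "i < m"
  shows "(\<lambda>w. pr w t i) \<in> borel_measurable (sample n P)"
  by (rule measurable_compose[OF measurable_price measurable_component_singleton])
     (use assms in auto)

lemma measurable_dist2:
  assumes "t \<in> {1..n}"
  shows "(\<lambda>w. dist2 w t) \<in> borel_measurable (sample n P)"
proof -
  have "(\<lambda>w. dist2 w t) = (\<lambda>w. \<Sum>i<m. (pr w t i - q i)\<^sup>2)"
    by (simp add: L2_set_def sum_nonneg)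
  also have "\<dots> \<in> borel_measurable (sample n P)"
    by (intro borel_measurable_power borel_measurable_sum borel_measurable_diff
        borel_measurable_const measurable_price_coord[OF assms]) simp
  finally show ?thesis .
qed

lemma measurable_gap:
  assumes t: "t \<in> {1..n}"
  shows "(\<lambda>w. gap w t) \<in> borel_measurable (sample n P)"
proof -
  have dot: "(\<lambda>w. dot m (snd (w t)) (p w)) \<in> borel_measurable (sample n P)"
    if "\<And>i. i < m \<Longrightarrow> (\<lambda>w. p w i) \<in> borel_measurable (sample n P)" for p
    unfolding dot_def
    by (intro borel_measurable_sum borel_measurable_times that
        measurable_compose[OF measurable_compose[OF measurable_sample_component[OF t]
          measurable_snd] measurable_component_singleton]) auto
  note fst = measurable_compose[OF measurable_sample_component[OF t] measurable_fst]
  have acc: "(\<lambda>w. indicator (accept_set m (p w)) (w t) :: real)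
      \<in> borel_measurable (sample n P)"
    if "\<And>i. i < m \<Longrightarrow> (\<lambda>w. p w i) \<in> borel_measurable (sample n P)" for p
    unfolding indicator_accept_set
    by (rule measurable_If[OF _ _ borel_measurable_less[OF dot[OF that] fst]]) auto
  show ?thesis
    unfolding price_gap_def
    by (intro borel_measurable_times borel_measurable_diff fst dot acc borel_measurable_const
        measurable_price_coord[OF t])
qed

lemma pred_price_Omega_p:
  assumes "t \<in> {1..n}"
  shows "Measurable.pred (sample n P) (\<lambda>w. pr w t \<in> Omega_p m rbar dlow)"
proof -
  have "{w \<in> space (sample n P). (\<forall>i\<in>{..<m}. 0 \<le> pr w t i) \<and> (\<Sum>i<m. pr w t i) \<le> rbar / dlow}
      \<in> sets (sample n P)"
    using assms
    by (intro sets.sets_Collect_conj sets.sets_Collect_finite_All borel_measurable_le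
        borel_measurable_sum borel_measurable_const measurable_price_coord finite_lessThan) auto
  then show ?thesis unfolding pred_def Omega_p_def mem_Collect_eq Ball_def lessThan_iff .
qed

text \<open>
  \<open>act w t\<close> and \<open>pr w t\<close> do not depend on \<open>w t\<close>, so the inner integral over \<open>w t\<close> sees a fixed
  price. The condition \<open>pr w t \<in> Omega_p\<close> is part of the integrand since \<open>prices\<close> only holds almost
  surely.
\<close>

lemma nn_integral_gap_le:
  assumes t: "t \<in> {1..n}"
  defines "A \<equiv> \<lambda>w. act w t \<and> pr w t \<in> Omega_p m rbar dlow"
  shows "(\<integral>\<^sup>+w. ennreal (if A w then gap w t else 0) \<partial>sample n P)
    \<le> (\<integral>\<^sup>+w. ennreal (mu * abar\<^sup>2 * (if act w t then dist2 w t else 0)) \<partial>sample n P)"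
proof -
  let ?I = "{1..n} - {t}"
  interpret product_sigma_finite "\<lambda>_::nat. P" by standard
  \<comment> \<open>Splitting off the coordinate \<open>t\<close> makes its integral the inner one
    in the product formula.\<close>
  have I: "{1..n} = insert t ?I" using t by auto
  have tn: "t \<le> n" using t by simp
  have act: "{w \<in> space (sample n P). act w t} \<in> sets (sample n P)"
    using measurable_active[OF tn] by (simp add: pred_def)
  have A: "{w \<in> space (sample n P). A w} \<in> sets (sample n P)"
    unfolding A_def by (rule sets.sets_Collect_conj[OF pred_price_Omega_p[OF t, unfolded pred_def] act])
  have f: "(\<lambda>w. ennreal (if A w then gap w t else 0)) \<in> borel_measurable (Pi\<^sub>M (insert t ?I) (\<lambda>_. P))"
    unfolding I[symmetric]
    by (intro measurable_compose[OF _ measurable_ennreal] measurable_If measurable_gap t A) auto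
  have g: "(\<lambda>w. ennreal (mu * abar\<^sup>2 * (if act w t then dist2 w t else 0)))
      \<in> borel_measurable (Pi\<^sub>M (insert t ?I) (\<lambda>_. P))"
    unfolding I[symmetric]
    by (intro measurable_compose[OF _ measurable_ennreal] borel_measurable_times measurable_If
        measurable_dist2 t act) auto
  have pr_upd: "pr (w(t := z)) t = pr w t" for w z
    using t by (intro price_fun_upd) simp
  have A_upd: "A (w(t := z)) = A w" for w z
    by (simp add: A_def active_fun_upd pr_upd)
  have "(\<integral>\<^sup>+w. ennreal (if A w then gap w t else 0) \<partial>sample n P)
      = (\<integral>\<^sup>+w. \<integral>\<^sup>+z. ennreal (if A w then price_gap m q (pr w t) z else 0) \<partial>P \<partial>Pi\<^sub>M ?I (\<lambda>_. P))"
    using t by (subst I, subst product_nn_integral_insert[OF _ _ f])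
      (simp_all add: A_upd pr_upd cong: if_cong)
  also have "\<dots> \<le> (\<integral>\<^sup>+w. \<integral>\<^sup>+z. ennreal (mu * abar\<^sup>2 * (if act w t then dist2 w t else 0)) \<partial>P
      \<partial>Pi\<^sub>M ?I (\<lambda>_. P))"
  proof (rule nn_integral_mono)
    fix w
    show "(\<integral>\<^sup>+z. ennreal (if A w then price_gap m q (pr w t) z else 0) \<partial>P)
      \<le> (\<integral>\<^sup>+z. ennreal (mu * abar\<^sup>2 * (if act w t then dist2 w t else 0)) \<partial>P)"
    \<comment> \<open>Where \<open>A w\<close> fails, the left-hand integrand vanishes. Where it
      holds, the bound for a single arrival applies at a fixed price, and the right-hand integrand
      is constant in \<open>z\<close>.\<close>
    proof (cases "A w")
      case True
      then have "act w t" and "pr w t \<in> Omega_p m rbar dlow" by (auto simp: A_def)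
      with True show ?thesis
        using nn_integral_price_gap_le[of "pr w t"] by (simp add: emeasure_space_1)
    qed simp
  qed
  also have "\<dots> = (\<integral>\<^sup>+w. ennreal (mu * abar\<^sup>2 * (if act w t then dist2 w t else 0)) \<partial>sample n P)"
    using t by (subst I, subst product_nn_integral_insert[OF _ _ g])
      (simp_all add: active_fun_upd pr_upd cong: if_cong)
  finally show ?thesis .
qed

lemma AE_active_price: "AE w in sample n P. \<forall>t\<in>{1..n}. act w t \<longrightarrow> pr w t \<in> Omega_p m rbar dlow"
  using prices
proof eventually_elim
  case (elim w)
  show ?case
  proof (intro ballI impI)
    fix t assume t: "t \<in> {1..n}" "act w t"
    then have "t \<le> \<tau> w" using le_stop_time_iff[OF m_pos, of t n] by simp
    with elim t show "pr w t \<in> Omega_p m rbar dlow" by simp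
  qed
qed

text \<open>While the policy is active, \<open>pr w t\<close> almost surely lies in
  \<open>Omega_p\<close>, as does \<open>q\<close>, so their distance is at most
  \<open>2 * (rbar / dlow)\<close>.\<close>

lemma integrable_active_dist2:
  assumes t: "t \<in> {1..n}"
  shows "integrable (sample n P) (\<lambda>w. if act w t then dist2 w t else 0)"
proof -
  interpret S: prob_space "sample n P" by (rule prob_space_sample)
  show ?thesis
  proof (rule S.integrable_const_bound[where B = "(2 * (rbar / dlow))\<^sup>2"])
    show "AE w in sample n P. norm (if act w t then dist2 w t else 0) \<le> (2 * (rbar / dlow))\<^sup>2"
      using AE_active_price
    proof eventually_elim
      case (elim w)
      have "dist2 w t \<le> (2 * (rbar / dlow))\<^sup>2" if "act w t"
      proof (rule power_mono)
        have "L2_set (\<lambda>i. pr w t i - q i) {..<m} \<le> L2_set (pr w t) {..<m} + L2_set (\<lambda>i. - q i) {..<m}"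
          using L2_set_triangle_ineq[of "pr w t" "\<lambda>i. - q i" "{..<m}"] by simp
        also have "L2_set (\<lambda>i. - q i) {..<m} = L2_set q {..<m}" by (simp add: L2_set_def)
        finally show "L2_set (\<lambda>i. pr w t i - q i) {..<m} \<le> 2 * (rbar / dlow)"
          using L2_set_Omega_p[OF q_in_Omega_p] L2_set_Omega_p[of "pr w t" m rbar dlow] elim t that
          by fastforce
      qed simp
      then show ?case by simp
    qed
    show "(\<lambda>w. if act w t then dist2 w t else 0) \<in> borel_measurable (sample n P)"
      using measurable_active[of t] t
      by (intro measurable_If measurable_dist2) (auto simp: pred_def)
  qed
qed

lemma integral_active_gap_le:
  assumes t: "t \<in> {1..n}"
  shows "integrable (sample n P) (\<lambda>w. if act w t then gap w t else 0)"
    and "(\<integral>w. (if act w t then gap w t else 0) \<partial>sample n P)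
      \<le> mu * abar\<^sup>2 * (\<integral>w. (if act w t then dist2 w t else 0) \<partial>sample n P)"
proof -
  interpret S: prob_space "sample n P" by (rule prob_space_sample)
  let ?f = "\<lambda>w. if act w t then gap w t else 0"
  let ?g = "\<lambda>w. mu * abar\<^sup>2 * (if act w t then dist2 w t else 0)"
  show int: "integrable (sample n P) ?f"
  proof (rule S.integrable_const_bound[where B = surplus_bound])
    show "AE w in sample n P. norm (?f w) \<le> surplus_bound"
      using AE_sample
    proof eventually_elim
      case (elim w)
      then have "gap w t \<le> surplus_bound"
        using abs_surplus_le[of "w t"] price_gap_le_abs[of m q "pr w t" "w t"] t by fastforce
      then show ?case
        using price_gap_nonneg[of m q "pr w t" "w t"] surplus_bound_nonneg by simp
    qed
    show "?f \<in> borel_measurable (sample n P)"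
      using measurable_active[of t] t
      by (intro measurable_If measurable_gap) (auto simp: pred_def)
  qed
  have int_g: "integrable (sample n P) ?g"
    using integrable_active_dist2[OF t] by (rule integrable_mult_right)
  have "ennreal (\<integral>w. ?f w \<partial>sample n P) = (\<integral>\<^sup>+w. ennreal (?f w) \<partial>sample n P)"
    by (rule nn_integral_eq_integral[OF int, symmetric]) (simp add: price_gap_nonneg)
  also have "\<dots> = (\<integral>\<^sup>+w. ennreal (if act w t \<and> pr w t \<in> Omega_p m rbar dlow then gap w t else 0)
      \<partial>sample n P)"
    using AE_active_price by (intro nn_integral_cong_AE, eventually_elim) (use t in auto)
  also have "\<dots> \<le> (\<integral>\<^sup>+w. ennreal (?g w) \<partial>sample n P)"
    by (rule nn_integral_gap_le[OF t])
  also have "\<dots> = ennreal (\<integral>w. ?g w \<partial>sample n P)"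
    by (rule nn_integral_eq_integral[OF int_g]) (use mu in simp)
  finally have "(\<integral>w. ?f w \<partial>sample n P) \<le> (\<integral>w. ?g w \<partial>sample n P)"
    by (rule ennreal_le_iff[THEN iffD1, rotated]) (use mu in \<open>auto intro!: integral_nonneg_AE\<close>)
  then show "(\<integral>w. ?f w \<partial>sample n P)
      \<le> mu * abar\<^sup>2 * (\<integral>w. (if act w t then dist2 w t else 0) \<partial>sample n P)"
    by simp
qed

text \<open>A sum of random length becomes one over a fixed range, so that sum and expectation can
  be interchanged.\<close>

lemma sum_stop_time:
  "(\<Sum>t=1..\<tau> w. F t) = (\<Sum>t=1..n. if act w t then F t else (0::real))"
proof -
  have "{1..\<tau> w} = {t\<in>{1..n}. act w t}"
    using stop_time_le[of m n b h abar w] by (auto simp: le_stop_time_iff[where n = n, OF m_pos, symmetric])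
  then show ?thesis by (simp only: sum.inter_filter finite_atLeastAtMost)
qed

lemma stop_time_eq_sum: "real (\<tau> w) = (\<Sum>t=1..n. if act w t then 1 else 0)"
  unfolding sum_stop_time[of "\<lambda>_. 1" w, symmetric] by simp

lemma integrable_stop_time: "integrable (sample n P) (\<lambda>w. real (\<tau> w))"
proof -
  interpret S: prob_space "sample n P" by (rule prob_space_sample)
  have "integrable (sample n P) (\<lambda>w. if act w t then 1 else (0::real))" if "t \<in> {1..n}" for t
    using measurable_active[of t] that
    by (intro S.integrable_const_bound[where B = 1] measurable_If) (auto simp: pred_def)
  then show ?thesis unfolding stop_time_eq_sum by (rule Bochner_Integration.integrable_sum)
qed

text \<open>Take expectations in \<open>regret_le\<close> and bound the price gaps period by period.
  The three terms and their coefficients are non-negative, so each coefficient may be enlarged to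
  the sum of all three.\<close>

lemma expected_regret_le:
  "(\<integral>w. lp_value m n b w - revenue m n b h w \<partial>sample n P)
    \<le> (mu * abar\<^sup>2 + 2 * surplus_bound + rbar / dlow)
      * (\<integral>w. (\<Sum>t=1..\<tau> w. dist2 w t) + (real n - real (\<tau> w))
            + (\<Sum>i\<in>binding m P d q. rem w n i) \<partial>sample n P)"
    (is "?L \<le> ?K * (\<integral>w. ?D w + ?S w + ?B w \<partial>_)")
proof -
  interpret S: prob_space "sample n P" by (rule prob_space_sample)
  have D_nonneg: "0 \<le> ?D w" for w by (intro sum_nonneg) simp
  have S_nonneg: "0 \<le> ?S w" for w using stop_time_le[of m n b h abar w] by simp
  have B_nonneg: "0 \<le> ?B w" for w
    by (intro sum_nonneg remaining_nonneg[OF b_nonneg]) (auto simp: binding_def)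
  have coeffs: "0 \<le> mu * abar\<^sup>2" "0 \<le> 2 * surplus_bound" "0 \<le> rbar / dlow"
    using mu surplus_bound_nonneg bounds_nonneg dlow by auto
  have intD: "integrable (sample n P) ?D"
    unfolding sum_stop_time by (intro Bochner_Integration.integrable_sum integrable_active_dist2)
  have intS: "integrable (sample n P) ?S"
    by (intro Bochner_Integration.integrable_diff S.integrable_const integrable_stop_time)
  have intB: "integrable (sample n P) ?B"
    by (intro Bochner_Integration.integrable_sum integrable_remaining) (simp add: binding_def)
  show ?thesis
  proof (cases "integrable (sample n P) (\<lambda>w. lp_value m n b w - revenue m n b h w)")
    \<comment> \<open>A non-integrable regret has Bochner integral 0 by convention, and the
      right-hand side is non-negative, so measurability of \<open>lp_value\<close> never
      enters.\<close>
    case False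
    have "0 \<le> ?K * (\<integral>w. ?D w + ?S w + ?B w \<partial>sample n P)"
      by (intro mult_nonneg_nonneg add_nonneg_nonneg coeffs integral_nonneg_AE AE_I2
          D_nonneg S_nonneg B_nonneg)
    then show ?thesis by (simp only: not_integrable_integral_eq[OF False])
  next
    case True
    let ?G = "\<lambda>w. \<Sum>t=1..\<tau> w. gap w t"
    have intG: "integrable (sample n P) ?G"
      unfolding sum_stop_time by (intro Bochner_Integration.integrable_sum integral_active_gap_le(1))
    have "?L \<le> (\<integral>w. ?G w + 2 * surplus_bound * ?S w + rbar / dlow * ?B w \<partial>sample n P)"
    proof (rule integral_mono_AE[OF True])
      show "AE w in sample n P. lp_value m n b w - revenue m n b h w
          \<le> ?G w + 2 * surplus_bound * ?S w + rbar / dlow * ?B w"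
        using AE_sample by eventually_elim (rule regret_le, blast)
    qed (intro Bochner_Integration.integrable_add integrable_mult_right intG intS intB)
    also have "\<dots> = (\<integral>w. ?G w \<partial>sample n P) + 2 * surplus_bound * (\<integral>w. ?S w \<partial>sample n P)
        + rbar / dlow * (\<integral>w. ?B w \<partial>sample n P)"
      by (subst Bochner_Integration.integral_add;
          (subst Bochner_Integration.integral_add)?;
          (intro Bochner_Integration.integrable_add integrable_mult_right intG intS intB)?)
         (simp only: integral_mult_right_zero)
    also have "(\<integral>w. ?G w \<partial>sample n P) \<le> mu * abar\<^sup>2 * (\<integral>w. ?D w \<partial>sample n P)"
    proof -
      have "(\<integral>w. ?G w \<partial>sample n P) = (\<Sum>t=1..n. \<integral>w. (if act w t then gap w t else 0) \<partial>sample n P)"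
        unfolding sum_stop_time by (intro Bochner_Integration.integral_sum integral_active_gap_le(1))
      also have "\<dots> \<le> (\<Sum>t=1..n. mu * abar\<^sup>2 * (\<integral>w. (if act w t then dist2 w t else 0) \<partial>sample n P))"
        by (intro sum_mono integral_active_gap_le(2))
      also have "\<dots> = mu * abar\<^sup>2 * (\<integral>w. ?D w \<partial>sample n P)"
        unfolding sum_stop_time sum_distrib_left[symmetric]
        by (intro arg_cong[of _ _ "(*) (mu * abar\<^sup>2)"]
            Bochner_Integration.integral_sum[symmetric] integrable_active_dist2)
      finally show ?thesis .
    qed
    also have "mu * abar\<^sup>2 * (\<integral>w. ?D w \<partial>sample n P) + 2 * surplus_bound * (\<integral>w. ?S w \<partial>sample n P)
        + rbar / dlow * (\<integral>w. ?B w \<partial>sample n P)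
      \<le> ?K * (\<integral>w. ?D w \<partial>sample n P) + ?K * (\<integral>w. ?S w \<partial>sample n P) + ?K * (\<integral>w. ?B w \<partial>sample n P)"
      by (intro add_mono mult_right_mono integral_nonneg_AE AE_I2 D_nonneg S_nonneg B_nonneg)
         (use coeffs in linarith)+
    also have "\<dots> = ?K * (\<integral>w. ?D w + ?S w + ?B w \<partial>sample n P)"
    proof -
      have "(\<integral>w. ?D w + ?S w + ?B w \<partial>sample n P) = (\<integral>w. ?D w \<partial>sample n P)
          + (\<integral>w. ?S w \<partial>sample n P) + (\<integral>w. ?B w \<partial>sample n P)"
        using Bochner_Integration.integral_add[OF Bochner_Integration.integrable_add[OF intD intS] intB]
          Bochner_Integration.integral_add[OF intD intS] by (simp only:)
      then show ?thesis by (simp only: distrib_left)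
    qed
    finally show ?thesis by simp
  qed
qed

end

section \<open>The regret bound with one constant for all instances\<close>

theorem theorem2:
  fixes rbar abar dlow mu :: real
  shows "\<exists>K::real. \<forall>(dbar::real) (lmin::real) (lam::real) (m::nat) (n::nat) (b :: nat \<Rightarrow> real)
           (d :: nat \<Rightarrow> real) (P :: arrival measure) (pstar :: nat \<Rightarrow> real)
           (h :: nat \<Rightarrow> hist \<Rightarrow> nat \<Rightarrow> real).
      d = (\<lambda>i. b i / real n) \<longrightarrow>
      assumption1 rbar abar dlow dbar m n d P \<longrightarrow>
      assumption2 rbar dlow dbar lmin lam mu m d P \<longrightarrow>
      dual_opt m P d pstar \<longrightarrow>
      dual_policy m n h \<longrightarrow>
      (AE w in sample n P. \<forall>t\<in>{1..stop_time m n b h abar w}. price m b h w t \<in> Omega_p m rbar dlow) \<longrightarrow>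
      (\<integral>w. lp_value m n b w - revenue m n b h w \<partial>sample n P)
        \<le> K * (\<integral>w. (\<Sum>t=1..stop_time m n b h abar w.
                        (L2_set (\<lambda>i. price m b h w t i - pstar i) {..<m})\<^sup>2)
                    + (real n - real (stop_time m n b h abar w))
                    + (\<Sum>i\<in>binding m P d pstar. remaining m b h w n i) \<partial>sample n P)"
proof (intro exI[of _ "mu * abar\<^sup>2 + 2 * (rbar + abar * (rbar / dlow)) + rbar / dlow"] allI impI)
  \<comment> \<open>The constant is that of \<open>expected_regret_le\<close> with
    \<open>surplus_bound\<close> written out; it is chosen before \<open>m\<close>,
    \<open>n\<close>, \<open>P\<close> and the policy.\<close>
  fix dbar lmin lam :: real and m n :: nat and b d pstar :: "nat \<Rightarrow> real" and P :: "arrival measure"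
    and h :: "nat \<Rightarrow> hist \<Rightarrow> nat \<Rightarrow> real"
  assume d: "d = (\<lambda>i. b i / real n)"
    and a1: "assumption1 rbar abar dlow dbar m n d P"
    and a2: "assumption2 rbar dlow dbar lmin lam mu m d P"
    and opt: "dual_opt m P d pstar"
    and policy: "dual_policy m n h"
    and prices: "AE w in sample n P. \<forall>t\<in>{1..stop_time m n b h abar w}.
      price m b h w t \<in> Omega_p m rbar dlow"
  interpret prob_space P using a1 by (simp add: assumption1_def)
  have d_mem: "d \<in> Omega_d m dlow dbar" using a1 by (simp add: assumption1_def)
  \<comment> \<open>The assumption ranges over all of \<open>Omega_d\<close>; here it is taken at
    \<open>d\<close> itself with its optimum \<open>pstar\<close>.\<close>
  have lip: "AE z in P. \<bar>accept_cond_prob m P p z - accept_cond_prob m P pstar z\<bar>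
      \<le> mu * \<bar>dot m (snd z) p - dot m (snd z) pstar\<bar>" if "p \<in> Omega_p m rbar dlow" for p
  proof -
    have "AE z in P.
          lam * \<bar>dot m (snd z) p - dot m (snd z) pstar\<bar>
            \<le> \<bar>accept_cond_prob m P p z - accept_cond_prob m P pstar z\<bar> \<and>
          \<bar>accept_cond_prob m P p z - accept_cond_prob m P pstar z\<bar>
            \<le> mu * \<bar>dot m (snd z) p - dot m (snd z) pstar\<bar>"
      using a2 d_mem opt that unfolding assumption2_def by blast
    then show ?thesis by eventually_elim simp
  qed
  interpret online_policy P m rbar abar dlow mu d pstar n b h
  proof unfold_locales
    show "pstar i = 0 \<longleftrightarrow> 0 < slack m P d pstar i" if "i < m" for i
      using a2 opt that unfolding assumption2_def by blast
  qed (use a1 a2 d d_mem opt policy prices lip in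
      \<open>auto simp: assumption1_def assumption2_def Omega_d_def\<close>)
  show "(\<integral>w. lp_value m n b w - revenue m n b h w \<partial>sample n P)
        \<le> (mu * abar\<^sup>2 + 2 * (rbar + abar * (rbar / dlow)) + rbar / dlow)
          * (\<integral>w. (\<Sum>t=1..stop_time m n b h abar w.
                        (L2_set (\<lambda>i. price m b h w t i - pstar i) {..<m})\<^sup>2)
                    + (real n - real (stop_time m n b h abar w))
                    + (\<Sum>i\<in>binding m P d pstar. remaining m b h w n i) \<partial>sample n P)"
    by (rule expected_regret_le)
qed

end
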